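(* (Finite model property.) Let $\varepsilon\geq0$ be rational. For every $\varepsilon$-consistent formula $\phi\in\mathcal L$ there exists a CMP $(\mathcal M,m)$ whose support set $M$ is finite such that $m\models_\varepsilon\phi$.
   Context: A continuous Markov kernel (CMK) is $\mathcal M=(M,\Sigma,\theta)$ where $(M,\Sigma)$ is an analytic space with Borel $\sigma$-algebra $\Sigma$ and $\theta$ is a measurable map from $M$ to the space of (finite, nonnegative) measures on $(M,\Sigma)$ (with the $\sigma$-algebra generated by $\{\mu:\mu(S)\geq r\}$, $S\in\Sigma$, $r>0$); $M$ is its support set. A CMP is a pair $(\mathcal M,m)$ with $m\in M$. Formulae $\mathcal L$: $\phi::=\top\mid\neg\phi\mid\phi\land\phi\mid L_r\phi$, $r$ a nonnegative rational; $\bot=\neg\top$, $\to$ the usual abbreviation. $\varepsilon$-satisfaction: $m\models_\varepsilon\top$; $m\models_\varepsilon\neg\phi$ iff not $m\models_\varepsilon\phi$; $m\models_\varepsilon\phi\land\psi$ iff both; $m\models_\varepsilon L_r\phi$ iff $\theta(m)(\llbracket\phi\rrbracket_\varepsilon)+\varepsilon\geq r$, with $\llbracket\phi\rrbracket_\varepsilon=\{m'\in M:m'\models_\varepsilon\phi\}$. $\varepsilon$-provability: $\vdash_\varepsilon$ is the proof system consisting of classical propositional logic together with, for all $\phi,\psi\in\mathcal L$ and nonnegative rationals $r,s$: (A1) $L_\varepsilon\phi$; (A2) $L_{r+s}\phi\to L_r\phi$; (A3) $L_r(\phi\land\psi)\land L_s(\phi\land\neg\psi)\to L_{r+s-\varepsilon}\phi$;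 (A4) $\neg L_r(\phi\land\psi)\land\neg L_s(\phi\land\neg\psi)\to\neg L_{r+s-\varepsilon}\phi$; (R1) from $\vdash_\varepsilon\phi\to\psi$ infer $\vdash_\varepsilon L_r\phi\to L_r\psi$; (R2) from all of $\{L_r\phi\mid r<s\}$ infer $L_s\phi$; (R3) from all of $\{L_r\phi\mid r>s\}$ infer $\bot$. A formula $\phi$ is $\varepsilon$-consistent if $\phi\to\bot$ is not $\varepsilon$-provable. *)

theory Defs
  imports "HOL-Analysis.Analysis"
begin

section \<open>Nonnegative rationals\<close>

typedef nnrat = "{q :: rat. 0 \<le> q}"
  morphisms rat_of_nnrat Abs_nnrat
  by auto

setup_lifting type_definition_nnrat

instantiation nnrat :: "{comm_monoid_add, linorder}"
begin

lift_definition zero_nnrat :: nnrat is 0 by simp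

lift_definition plus_nnrat :: "nnrat \<Rightarrow> nnrat \<Rightarrow> nnrat" is "(+)" by simp

lift_definition less_eq_nnrat :: "nnrat \<Rightarrow> nnrat \<Rightarrow> bool" is "(\<le>)" .

lift_definition less_nnrat :: "nnrat \<Rightarrow> nnrat \<Rightarrow> bool" is "(<)" .

instance
  by standard (transfer; force)+

end

definition real_of_nnrat :: "nnrat \<Rightarrow> real" where
  "real_of_nnrat r = of_rat (rat_of_nnrat r)"


section \<open>Continuous Markov kernels\<close>

definition polish_topology :: "'a topology \<Rightarrow> bool" where
  "polish_topology X \<longleftrightarrow> completely_metrizable_space X \<and> separable_space X"

text \<open>An analytic space is the image of a Polish space under a continuous map into a Polish
  space, with the subspace topology. A Polish space has at most continuum many points, so that
  letting the two Polish spaces range over all topologies with points in \<^typ>\<open>real\<close> covers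
  every Polish space up to homeomorphism.\<close>

definition analytic_topology :: "'a topology \<Rightarrow> bool" where
  "analytic_topology T \<longleftrightarrow>
     (\<exists>(X :: real topology) (Y :: real topology) f.
        polish_topology X \<and> polish_topology Y \<and> continuous_map Y X f \<and>
        T homeomorphic_space subtopology X (f ` topspace Y))"

text \<open>Only the underlying measurable space of \<open>N\<close> matters here.\<close>

definition analytic_measurable_space :: "'a measure \<Rightarrow> bool" where
  "analytic_measurable_space N \<longleftrightarrow>
     (\<exists>T. analytic_topology T \<and> space N = topspace T \<and>
        sets N = sigma_sets (topspace T) {U. openin T U})"

definition finite_measures :: "'a measure \<Rightarrow> 'a measure set" where
  "finite_measures N = {\<mu>. sets \<mu> = sets N \<and> finite_measure \<mu>}"

text \<open>Like \<open>subprob_algebra\<close>, but for all finite measures.\<close>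

definition finite_measure_algebra :: "'a measure \<Rightarrow> 'a measure measure" where
  "finite_measure_algebra N =
     sigma (finite_measures N)
       {{\<mu> \<in> finite_measures N. measure \<mu> S \<ge> r} | S r. S \<in> sets N \<and> (r :: real) > 0}"

definition CMK :: "'a measure \<Rightarrow> ('a \<Rightarrow> 'a measure) \<Rightarrow> bool" where
  "CMK N \<theta> \<longleftrightarrow> analytic_measurable_space N \<and> \<theta> \<in> N \<rightarrow>\<^sub>M finite_measure_algebra N"

definition CMP :: "'a measure \<Rightarrow> ('a \<Rightarrow> 'a measure) \<Rightarrow> 'a \<Rightarrow> bool" where
  "CMP N \<theta> m \<longleftrightarrow> CMK N \<theta> \<and> m \<in> space N"


section \<open>Formulae and satisfaction\<close>

datatype fm = Top | Neg fm | And fm fm | L nnrat fm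

abbreviation Bot :: fm where
  "Bot \<equiv> Neg Top"

abbreviation Imp :: "fm \<Rightarrow> fm \<Rightarrow> fm" where
  "Imp \<phi> \<psi> \<equiv> Neg (And \<phi> (Neg \<psi>))"

primrec sat :: "nnrat \<Rightarrow> 'a measure \<Rightarrow> ('a \<Rightarrow> 'a measure) \<Rightarrow> fm \<Rightarrow> 'a \<Rightarrow> bool" where
  "sat \<epsilon> N \<theta> Top m \<longleftrightarrow> True"
| "sat \<epsilon> N \<theta> (Neg \<phi>) m \<longleftrightarrow> \<not> sat \<epsilon> N \<theta> \<phi> m"
| "sat \<epsilon> N \<theta> (And \<phi> \<psi>) m \<longleftrightarrow> sat \<epsilon> N \<theta> \<phi> m \<and> sat \<epsilon> N \<theta> \<psi> m"
| "sat \<epsilon> N \<theta> (L r \<phi>) m \<longleftrightarrow>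
     measure (\<theta> m) {m' \<in> space N. sat \<epsilon> N \<theta> \<phi> m'} + real_of_nnrat \<epsilon> \<ge> real_of_nnrat r"


section \<open>Provability\<close>

text \<open>Propositional evaluation: formulae \<^term>\<open>L r \<phi>\<close> are treated as atoms.\<close>

primrec prop_eval :: "(nnrat \<Rightarrow> fm \<Rightarrow> bool) \<Rightarrow> fm \<Rightarrow> bool" where
  "prop_eval v Top \<longleftrightarrow> True"
| "prop_eval v (Neg \<phi>) \<longleftrightarrow> \<not> prop_eval v \<phi>"
| "prop_eval v (And \<phi> \<psi>) \<longleftrightarrow> prop_eval v \<phi> \<and> prop_eval v \<psi>"
| "prop_eval v (L r \<phi>) \<longleftrightarrow> v r \<phi>"

definition tautology :: "fm \<Rightarrow> bool" where
  "tautology \<phi> \<longleftrightarrow> (\<forall>v. prop_eval v \<phi>)"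

text \<open>Derivability from a set of hypotheses; provability is derivability from the empty set.
  Rule \<open>R1\<close> applies to provable implications only, while the infinitary rules \<open>R2\<close> and
  \<open>R3\<close> may be used under hypotheses. With infinitary rules the
  deduction theorem need not be admissible, so implication introduction is one of the propositional
  rules. In \<open>A3\<close> and \<open>A4\<close>, the index \<open>t\<close> is the nonnegative rational
  \<open>r + s - \<epsilon>\<close>; there is no instance if that number is negative.\<close>

inductive derives :: "nnrat \<Rightarrow> fm set \<Rightarrow> fm \<Rightarrow> bool" for \<epsilon> :: nnrat where
  Hyp: "\<phi> \<in> \<Gamma> \<Longrightarrow> derives \<epsilon> \<Gamma> \<phi>"
| Taut: "tautology \<phi> \<Longrightarrow> derives \<epsilon> \<Gamma> \<phi>"
| MP: "derives \<epsilon> \<Gamma> (Imp \<phi> \<psi>) \<Longrightarrow> derives \<epsilon> \<Gamma> \<phi> \<Longrightarrow> derives \<epsilon> \<Gamma> \<psi>"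
| ImpI: "derives \<epsilon> (insert \<phi> \<Gamma>) \<psi> \<Longrightarrow> derives \<epsilon> \<Gamma> (Imp \<phi> \<psi>)"
| A1: "derives \<epsilon> \<Gamma> (L \<epsilon> \<phi>)"
| A2: "derives \<epsilon> \<Gamma> (Imp (L (r + s) \<phi>) (L r \<phi>))"
| A3: "t + \<epsilon> = r + s \<Longrightarrow>
    derives \<epsilon> \<Gamma> (Imp (And (L r (And \<phi> \<psi>)) (L s (And \<phi> (Neg \<psi>)))) (L t \<phi>))"
| A4: "t + \<epsilon> = r + s \<Longrightarrow>
    derives \<epsilon> \<Gamma>
      (Imp (And (Neg (L r (And \<phi> \<psi>))) (Neg (L s (And \<phi> (Neg \<psi>))))) (Neg (L t \<phi>)))"
| R1: "derives \<epsilon> {} (Imp \<phi> \<psi>) \<Longrightarrow> derives \<epsilon> \<Gamma> (Imp (L r \<phi>) (L r \<psi>))"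
| R2: "(\<And>r. r < s \<Longrightarrow> derives \<epsilon> \<Gamma> (L r \<phi>)) \<Longrightarrow> derives \<epsilon> \<Gamma> (L s \<phi>)"
| R3: "(\<And>r. r > s \<Longrightarrow> derives \<epsilon> \<Gamma> (L r \<phi>)) \<Longrightarrow> derives \<epsilon> \<Gamma> Bot"

definition provable :: "nnrat \<Rightarrow> fm \<Rightarrow> bool" where
  "provable \<epsilon> \<phi> \<longleftrightarrow> derives \<epsilon> {} \<phi>"

definition consistent :: "nnrat \<Rightarrow> fm \<Rightarrow> bool" where
  "consistent \<epsilon> \<phi> \<longleftrightarrow> \<not> provable \<epsilon> (Imp \<phi> Bot)"

end

theory Submission
  imports Defs
begin

text \<open>
  Enumerating the countably many instances of the infinitary rules, a consistent set is extended to
  a maximal set \<open>U\<close> respecting these rules. For such \<open>U\<close>, the value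
  \<open>sup {r. L r \<xi> \<in> U} - \<epsilon>\<close> is a nonnegative and, by \<open>A3\<close> and \<open>A4\<close>, finitely additive function
  of \<open>\<xi>\<close>, and the supremum is attained. The points of the model are the consistent complete types
  over the subformulae of \<open>\<phi>\<close>. A type \<open>t\<close> is extended to some \<open>U\<close> as above, and the mass
  that \<open>t\<close> gives to a type \<open>t'\<close> is the value of \<open>U\<close> at the conjunction describing \<open>t'\<close>.
\<close>

section \<open>Nonnegative rationals\<close>

lemma real_of_nnrat_nonneg [simp]: "0 \<le> real_of_nnrat r"
  unfolding real_of_nnrat_def using rat_of_nnrat[of r] by simp

lemma real_of_nnrat_add [simp]: "real_of_nnrat (r + s) = real_of_nnrat r + real_of_nnrat s"
  by (simp add: real_of_nnrat_def plus_nnrat.rep_eq of_rat_add)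

lemma real_of_nnrat_less_iff [simp]: "real_of_nnrat r < real_of_nnrat s \<longleftrightarrow> r < s"
  by (simp add: real_of_nnrat_def less_nnrat.rep_eq of_rat_less)

lemma real_of_nnrat_le_iff [simp]: "real_of_nnrat r \<le> real_of_nnrat s \<longleftrightarrow> r \<le> s"
  by (simp add: real_of_nnrat_def less_eq_nnrat.rep_eq of_rat_less_eq)

lemma nnrat_le_imp_add:
  assumes "r \<le> s"
  obtains t where "s = r + (t :: nnrat)"
proof
  show "s = r + Abs_nnrat (rat_of_nnrat s - rat_of_nnrat r)"
    using assms
    by (simp add: rat_of_nnrat_inject[symmetric] plus_nnrat.rep_eq less_eq_nnrat.rep_eq
        Abs_nnrat_inverse)
qed

lemma nnrat_dense:
  assumes "0 \<le> a" "a < b"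
  obtains r where "a < real_of_nnrat r" "real_of_nnrat r < b"
proof -
  obtain q where q: "a < of_rat q" "of_rat q < b"
    using of_rat_dense[OF assms(2)] by blast
  have "0 \<le> q" using q(1) assms(1) by (metis less_eq_real_def order.trans zero_le_of_rat_iff)
  then show ?thesis
    using that[of "Abs_nnrat q"] q by (simp add: real_of_nnrat_def Abs_nnrat_inverse)
qed

text \<open>Together with the countability of \<open>fm\<close>, this makes the rule instances
  enumerable in the construction of saturated sets.\<close>

instance nnrat :: countable
proof
  show "\<exists>to_nat :: nnrat \<Rightarrow> nat. inj to_nat"
    by (rule exI[of _ "to_nat \<circ> rat_of_nnrat"])
      (auto simp: inj_on_def rat_of_nnrat_inject)
qed

instance fm :: countable
  by countable_datatype


section \<open>Derivability\<close>

text \<open>\<open>ImpI\<close> changes the hypothesis set, so the larger set is generalized in the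
  induction. \<open>R1\<close> is no obstacle because its premise is derived from the empty
  set.\<close>

lemma derives_weaken: "derives \<epsilon> \<Gamma> \<xi> \<Longrightarrow> \<Gamma> \<subseteq> \<Delta> \<Longrightarrow> derives \<epsilon> \<Delta> \<xi>"
proof (induction arbitrary: \<Delta> rule: derives.induct)
  case (MP \<Gamma> \<phi> \<psi>)
  then show ?case using derives.MP by blast
next
  case (ImpI \<phi> \<Gamma> \<psi>)
  then show ?case by (meson derives.ImpI insert_mono)
next
  case (R2 s \<Gamma> \<phi>)
  then show ?case using derives.R2 by blast
next
  case (R3 s \<Gamma> \<phi>)
  then show ?case using derives.R3 by blast
qed (auto intro: derives.intros)

text \<open>With all tautologies available through \<open>Taut\<close>, propositional derivations
  reduce to checks on valuations; this lemma and the next carry out all such steps.\<close>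

lemma derives_taut_1:
  assumes "derives \<epsilon> \<Gamma> \<phi>" "\<And>v. prop_eval v \<phi> \<Longrightarrow> prop_eval v \<xi>"
  shows "derives \<epsilon> \<Gamma> \<xi>"
  using assms(2) by (intro derives.MP[OF derives.Taut assms(1)]) (auto simp: tautology_def)

lemma derives_taut_2:
  assumes "derives \<epsilon> \<Gamma> \<phi>" "derives \<epsilon> \<Gamma> \<psi>"
    and "\<And>v. prop_eval v \<phi> \<Longrightarrow> prop_eval v \<psi> \<Longrightarrow> prop_eval v \<xi>"
  shows "derives \<epsilon> \<Gamma> \<xi>"
proof (rule derives.MP[OF _ assms(2)], rule derives_taut_1[OF assms(1)])
  show "prop_eval v (Imp \<psi> \<xi>)" if "prop_eval v \<phi>" for v
    using that assms(3) by simp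
qed

lemma derives_by_contradiction:
  assumes "derives \<epsilon> (insert (Neg \<xi>) \<Gamma>) Bot"
  shows "derives \<epsilon> \<Gamma> \<xi>"
  by (rule derives_taut_1[OF derives.ImpI[OF assms]]) simp

lemma derives_Bot_cut:
  assumes "derives \<epsilon> \<Gamma> \<xi>" "derives \<epsilon> (insert \<xi> \<Gamma>) Bot"
  shows "derives \<epsilon> \<Gamma> Bot"
  by (rule derives.MP[OF derives.ImpI[OF assms(2)] assms(1)])


section \<open>Saturated sets\<close>

text \<open>A Rasiowa-Sikorski construction: each member of the countable family is a requirement,
  and stage n meets the n-th one by adding a single element. A finite subset of the union lies in
  one stage, hence satisfies \<open>C\<close>. The union itself may fail \<open>C\<close>, since an
  infinitary rule can draw on all stages at once.\<close>

lemma generic_extension: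
  assumes "C A" and anti: "\<And>B B'. C B \<Longrightarrow> B' \<subseteq> B \<Longrightarrow> C B'"
    and \<D>: "countable \<D>" "\<D> \<noteq> {}"
    and ext: "\<And>B D. C B \<Longrightarrow> D \<in> \<D> \<Longrightarrow> \<exists>x\<in>D. C (insert x B)"
  obtains U where "A \<subseteq> U" "\<And>D. D \<in> \<D> \<Longrightarrow> \<exists>x\<in>D. x \<in> U"
    "\<And>F. finite F \<Longrightarrow> F \<subseteq> U \<Longrightarrow> C F"
proof -
  define D where "D = from_nat_into \<D>"
  have D: "D n \<in> \<D>" for n
    unfolding D_def by (rule from_nat_into[OF \<D>(2)])
  have "\<exists>G. \<forall>n. (C (G n) \<and> A \<subseteq> G n) \<and> G n \<subseteq> G (Suc n) \<and> (\<exists>x\<in>D n. x \<in> G (Suc n))"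
  proof (rule dependent_nat_choice)
    show "\<exists>B. C B \<and> A \<subseteq> B" using assms(1) by blast
    show "\<exists>B'. (C B' \<and> A \<subseteq> B') \<and> B \<subseteq> B' \<and> (\<exists>x\<in>D n. x \<in> B')" if B: "C B \<and> A \<subseteq> B" for B n
    proof -
      obtain x where "x \<in> D n" "C (insert x B)" using ext[OF _ D] B by blast
      then show ?thesis using B by (intro exI[of _ "insert x B"]) auto
    qed
  qed
  then obtain G where C: "\<And>n. C (G n)" and A: "\<And>n. A \<subseteq> G n"
    and G: "\<And>n. G n \<subseteq> G (Suc n)" and hit: "\<And>n. \<exists>x\<in>D n. x \<in> G (Suc n)"
    by blast
  show ?thesis
  proof
    show "A \<subseteq> (\<Union>n. G n)" using A by blast
    show "\<exists>x\<in>E. x \<in> (\<Union>n. G n)" if E: "E \<in> \<D>" for E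
    proof -
      obtain n where "D n = E"
        unfolding D_def using from_nat_into_surj[OF \<D>(1) E] by blast
      then show ?thesis using hit[of n] by blast
    qed
    show "C F" if "finite F" "F \<subseteq> (\<Union>n. G n)" for F
    proof -
      have "\<exists>n. F \<subseteq> G n"
        using that
      proof (induction F)
        case (insert x F)
        then obtain n k where "F \<subseteq> G n" "x \<in> G k" by blast
        then have "insert x F \<subseteq> G (max n k)"
          using lift_Suc_mono_le[of G, OF G] by (meson insert_subset max.cobounded1 max.cobounded2
              subset_iff subset_trans)
        then show ?case by blast
      qed simp
      then show ?thesis using C anti by blast
    qed
  qed
qed

text \<open>\<open>L_limit\<close> and \<open>L_bounded\<close> express closure under
  \<open>R2\<close> and \<open>R3\<close> by witnesses: if a conclusion is rejected, some premise is
  explicitly rejected.\<close>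

locale saturated =
  fixes \<epsilon> :: nnrat and U :: "fm set"
  assumes finitely_consistent: "finite \<Delta> \<Longrightarrow> \<Delta> \<subseteq> U \<Longrightarrow> \<not> derives \<epsilon> \<Delta> Bot"
    and decides: "\<xi> \<in> U \<or> Neg \<xi> \<in> U"
    and L_limit: "L s \<xi> \<in> U \<or> (\<exists>r<s. Neg (L r \<xi>) \<in> U)"
    and L_bounded: "\<exists>r. Neg (L r \<xi>) \<in> U"

lemma saturated_extension:
  assumes "\<not> derives \<epsilon> \<Gamma> Bot"
  obtains U where "saturated \<epsilon> U" "\<Gamma> \<subseteq> U"
proof -
  \<comment> \<open>The three families of requirements decide every formula, respect every instance
    of \<open>R2\<close>, and respect \<open>R3\<close> for every formula.\<close>
  define \<D> where "\<D> = range (\<lambda>\<xi>. {\<xi>, Neg \<xi>})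
    \<union> range (\<lambda>(s, \<xi>). insert (L s \<xi>) {Neg (L r \<xi>) |r. r < s})
    \<union> range (\<lambda>\<xi>. {Neg (L r \<xi>) |r. True})"
  \<comment> \<open>If every choice in \<open>D\<close> were inconsistent with \<open>B\<close>,
    then \<open>B\<close> would derive by contradiction each premise of the corresponding rule,
    hence its conclusion, and so be inconsistent itself.\<close>
  have ext: "\<exists>x\<in>D. \<not> derives \<epsilon> (insert x B) Bot" if B: "\<not> derives \<epsilon> B Bot" and D: "D \<in> \<D>" for B D
  proof (rule ccontr)
    assume "\<not> ?thesis"
    then have inc: "derives \<epsilon> (insert x B) Bot" if "x \<in> D" for x using that by blast
    consider \<xi> where "D = {\<xi>, Neg \<xi>}"
      | s \<xi> where "D = insert (L s \<xi>) {Neg (L r \<xi>) |r. r < s}"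
      | \<xi> where "D = {Neg (L r \<xi>) |r. True}"
      using D unfolding \<D>_def by auto
    then have "derives \<epsilon> B Bot"
    proof cases
      case (1 \<xi>)
      have "derives \<epsilon> B \<xi>" by (rule derives_by_contradiction, rule inc) (simp add: 1)
      moreover have "derives \<epsilon> (insert \<xi> B) Bot" using 1 by (intro inc) simp
      ultimately show ?thesis by (rule derives_Bot_cut)
    next
      case (2 s \<xi>)
      have "derives \<epsilon> B (L s \<xi>)"
      proof (rule derives.R2)
        show "derives \<epsilon> B (L r \<xi>)" if "r < s" for r
          by (rule derives_by_contradiction, rule inc) (use 2 that in blast)
      qed
      moreover have "derives \<epsilon> (insert (L s \<xi>) B) Bot" using 2 by (intro inc) simp
      ultimately show ?thesis by (rule derives_Bot_cut)
    next
      case (3 \<xi>)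
      show ?thesis
      proof (rule derives.R3)
        show "derives \<epsilon> B (L r \<xi>)" for r
          by (rule derives_by_contradiction, rule inc) (use 3 in blast)
      qed
    qed
    then show False using B by contradiction
  qed
  obtain U where U: "\<Gamma> \<subseteq> U" "\<And>D. D \<in> \<D> \<Longrightarrow> \<exists>x\<in>D. x \<in> U"
    "\<And>F. finite F \<Longrightarrow> F \<subseteq> U \<Longrightarrow> \<not> derives \<epsilon> F Bot"
  proof (rule generic_extension[of "\<lambda>\<Gamma>. \<not> derives \<epsilon> \<Gamma> Bot" \<Gamma> \<D>])
    show "\<not> derives \<epsilon> \<Gamma> Bot" by (rule assms)
    show "\<not> derives \<epsilon> B' Bot" if "\<not> derives \<epsilon> B Bot" "B' \<subseteq> B" for B B'
      using that derives_weaken by metis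
    show "\<exists>x\<in>D. \<not> derives \<epsilon> (insert x B) Bot" if "\<not> derives \<epsilon> B Bot" "D \<in> \<D>" for B D
      using that by (rule ext)
    show "countable \<D>" unfolding \<D>_def by (intro countable_Un countable_image) auto
    show "\<D> \<noteq> {}" unfolding \<D>_def by blast
  qed blast
  have "saturated \<epsilon> U"
  proof
    show "\<xi> \<in> U \<or> Neg \<xi> \<in> U" for \<xi>
      using U(2)[of "{\<xi>, Neg \<xi>}"] unfolding \<D>_def by blast
    show "L s \<xi> \<in> U \<or> (\<exists>r<s. Neg (L r \<xi>) \<in> U)" for s \<xi>
      using U(2)[of "insert (L s \<xi>) {Neg (L r \<xi>) |r. r < s}"] unfolding \<D>_def by blast
    show "\<exists>r. Neg (L r \<xi>) \<in> U" for \<xi>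
      using U(2)[of "{Neg (L r \<xi>) |r. True}"] unfolding \<D>_def by blast
    show "\<not> derives \<epsilon> \<Delta> Bot" if "finite \<Delta>" "\<Delta> \<subseteq> U" for \<Delta>
      using that by (rule U(3))
  qed
  then show ?thesis using U(1) by (rule that)
qed

section \<open>Membership in a saturated set and its weight function\<close>

context saturated
begin

lemma closed:
  assumes "finite \<Delta>" "\<Delta> \<subseteq> U" "derives \<epsilon> \<Delta> \<xi>"
  shows "\<xi> \<in> U"
proof (rule ccontr)
  assume "\<xi> \<notin> U"
  then have "insert (Neg \<xi>) \<Delta> \<subseteq> U" using decides assms(2) by blast
  moreover have "derives \<epsilon> (insert (Neg \<xi>) \<Delta>) Bot"
    by (rule derives_taut_2[OF derives_weaken[OF assms(3)] derives.Hyp]) auto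
  ultimately show False using finitely_consistent assms(1) by blast
qed

lemma MP_mem: "derives \<epsilon> {} (Imp \<phi> \<psi>) \<Longrightarrow> \<phi> \<in> U \<Longrightarrow> \<psi> \<in> U"
  by (rule closed[of "{\<phi>}"]) (auto intro: derives.MP derives.Hyp derives_weaken)

lemma Neg_mem_iff [simp]: "Neg \<xi> \<in> U \<longleftrightarrow> \<xi> \<notin> U"
proof -
  have "derives \<epsilon> {\<xi>, Neg \<xi>} Bot"
    by (rule derives_taut_2[OF derives.Hyp[of \<xi>] derives.Hyp[of "Neg \<xi>"]]) auto
  then show ?thesis using finitely_consistent[of "{\<xi>, Neg \<xi>}"] decides by blast
qed

lemma And_mem_iff [simp]: "And \<phi> \<psi> \<in> U \<longleftrightarrow> \<phi> \<in> U \<and> \<psi> \<in> U"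
proof -
  have "\<phi> \<in> U" if "And \<phi> \<psi> \<in> U"
    by (rule MP_mem[OF derives.Taut that]) (simp add: tautology_def)
  moreover have "\<psi> \<in> U" if "And \<phi> \<psi> \<in> U"
    by (rule MP_mem[OF derives.Taut that]) (simp add: tautology_def)
  moreover have "derives \<epsilon> {\<phi>, \<psi>} (And \<phi> \<psi>)"
    by (rule derives_taut_2[OF derives.Hyp[of \<phi>] derives.Hyp[of \<psi>]]) auto
  ultimately show ?thesis using closed[of "{\<phi>, \<psi>}"] by blast
qed

lemma Top_mem [simp]: "Top \<in> U"
  by (rule closed[of "{}"]) (auto intro: derives.Taut simp: tautology_def)

text \<open>This plays the role of the measure of \<open>\<xi>\<close> plus
  \<open>\<epsilon>\<close>, the quantity compared with \<open>r\<close> in the semantics of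
  \<open>L r \<xi>\<close>.\<close>

definition level :: "fm \<Rightarrow> real" where
  "level \<xi> = Sup {real_of_nnrat r |r. L r \<xi> \<in> U}"

lemma L_mem_mono: "L s \<xi> \<in> U \<Longrightarrow> r \<le> s \<Longrightarrow> L r \<xi> \<in> U"
  by (metis MP_mem derives.A2 nnrat_le_imp_add)

lemma eps_mem: "L \<epsilon> \<xi> \<in> U"
  by (rule closed[of "{}"]) (auto intro: derives.A1)

text \<open>These facts make the real supremum meaningful: the bound comes from the requirement for
  \<open>R3\<close>, nonemptiness from \<open>A1\<close>.\<close>

lemma level_set: "bdd_above {real_of_nnrat r |r. L r \<xi> \<in> U}" "{real_of_nnrat r |r. L r \<xi> \<in> U} \<noteq> {}"
proof -
  obtain b where "L b \<xi> \<notin> U" using L_bounded by auto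
  then have "r \<le> b" if "L r \<xi> \<in> U" for r
    using that L_mem_mono linear by blast
  then show "bdd_above {real_of_nnrat r |r. L r \<xi> \<in> U}"
    by (auto intro!: bdd_aboveI[of _ "real_of_nnrat b"])
qed (use eps_mem in blast)

lemma less_levelE:
  assumes "x < level \<xi>"
  obtains r where "L r \<xi> \<in> U" "x < real_of_nnrat r"
  using assms less_cSup_iff[OF level_set(2,1)] unfolding level_def by blast

text \<open>The supremum is attained because of \<open>R2\<close>: all smaller rationals are
  accepted by \<open>A2\<close>, so \<open>L_limit\<close> leaves no witness against
  \<open>L r \<xi>\<close>. This equivalence is what the modal case of the truth lemma
  needs.\<close>

lemma L_mem_iff: "L r \<xi> \<in> U \<longleftrightarrow> real_of_nnrat r \<le> level \<xi>"
proof
  show "real_of_nnrat r \<le> level \<xi>" if "L r \<xi> \<in> U"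
    unfolding level_def by (rule cSup_upper) (use that level_set in auto)
  assume le: "real_of_nnrat r \<le> level \<xi>"
  have "L q \<xi> \<in> U" if q: "q < r" for q
  proof -
    obtain p where "L p \<xi> \<in> U" "real_of_nnrat q < real_of_nnrat p"
      using q le less_levelE[of "real_of_nnrat q" \<xi>]
      by (metis less_le_trans real_of_nnrat_less_iff)
    then show ?thesis using L_mem_mono by (simp add: less_imp_le)
  qed
  then show "L r \<xi> \<in> U" using L_limit[of r \<xi>] by auto
qed

definition weight :: "fm \<Rightarrow> real" where
  "weight \<xi> = level \<xi> - real_of_nnrat \<epsilon>"

lemma weight_nonneg: "0 \<le> weight \<xi>"
  using eps_mem unfolding weight_def by (simp add: L_mem_iff)

text \<open>\<open>A3\<close> is applied to rationals \<open>r\<close> and \<open>s\<close> that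
  approximate the two levels from below.\<close>

lemma weight_superadditive: "weight (And \<xi> \<psi>) + weight (And \<xi> (Neg \<psi>)) \<le> weight \<xi>"
proof (rule ccontr)
  assume neg: "\<not> ?thesis"
  \<comment> \<open>Half the assumed gap: a loss below \<delta> in each approximation still leaves
    \<open>r + s - \<epsilon>\<close> above the level of \<open>\<xi>\<close>.\<close>
  define \<delta> where "\<delta> = (weight (And \<xi> \<psi>) + weight (And \<xi> (Neg \<psi>)) - weight \<xi>) / 2"
  have "\<delta> > 0" using neg unfolding \<delta>_def by simp
  obtain r where r: "L r (And \<xi> \<psi>) \<in> U" "level (And \<xi> \<psi>) - \<delta> < real_of_nnrat r"
    by (rule less_levelE[of "level (And \<xi> \<psi>) - \<delta>" "And \<xi> \<psi>"]) (use \<open>\<delta> > 0\<close> in auto)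
  obtain s where s: "L s (And \<xi> (Neg \<psi>)) \<in> U" "level (And \<xi> (Neg \<psi>)) - \<delta> < real_of_nnrat s"
    by (rule less_levelE[of "level (And \<xi> (Neg \<psi>)) - \<delta>" "And \<xi> (Neg \<psi>)"])
      (use \<open>\<delta> > 0\<close> in auto)
  have less: "weight \<xi> + 2 * real_of_nnrat \<epsilon> < real_of_nnrat (r + s)"
    using r(2) s(2) unfolding \<delta>_def weight_def real_of_nnrat_add by argo
  \<comment> \<open>Without this inequality there would be no instance of \<open>A3\<close> for
    \<open>r\<close> and \<open>s\<close>.\<close>
  then have "\<epsilon> \<le> r + s"
    using weight_nonneg[of \<xi>] real_of_nnrat_nonneg[of \<epsilon>] unfolding real_of_nnrat_le_iff[symmetric]
    by linarith
  then obtain t where t: "r + s = \<epsilon> + t" by (rule nnrat_le_imp_add)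
  have "L t \<xi> \<in> U"
    by (rule MP_mem[OF derives.A3[of t \<epsilon> r s _ \<xi> \<psi>]]) (use r s t in \<open>auto simp: add.commute\<close>)
  then have "real_of_nnrat t \<le> level \<xi>" by (simp add: L_mem_iff)
  then show False using less unfolding t weight_def by simp
qed

text \<open>Dually, \<open>A4\<close> is applied to rationals strictly above the two levels, so that
  both modal formulae are rejected.\<close>

lemma weight_subadditive: "weight \<xi> \<le> weight (And \<xi> \<psi>) + weight (And \<xi> (Neg \<psi>))"
proof (rule ccontr)
  assume neg: "\<not> ?thesis"
  define \<delta> where "\<delta> = (weight \<xi> - weight (And \<xi> \<psi>) - weight (And \<xi> (Neg \<psi>))) / 2"
  have "\<delta> > 0" using neg unfolding \<delta>_def by simp
  have level_ge: "real_of_nnrat \<epsilon> \<le> level \<zeta>" for \<zeta>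
    using eps_mem by (simp add: L_mem_iff)
  then have level_nonneg: "0 \<le> level \<zeta>" for \<zeta>
    using real_of_nnrat_nonneg order_trans by blast
  obtain r where r: "level (And \<xi> \<psi>) < real_of_nnrat r" "real_of_nnrat r < level (And \<xi> \<psi>) + \<delta>"
    by (rule nnrat_dense[of "level (And \<xi> \<psi>)" "level (And \<xi> \<psi>) + \<delta>"])
      (use level_nonneg \<open>\<delta> > 0\<close> in auto)
  obtain s where s: "level (And \<xi> (Neg \<psi>)) < real_of_nnrat s"
    "real_of_nnrat s < level (And \<xi> (Neg \<psi>)) + \<delta>"
    by (rule nnrat_dense[of "level (And \<xi> (Neg \<psi>))" "level (And \<xi> (Neg \<psi>)) + \<delta>"])
      (use level_nonneg \<open>\<delta> > 0\<close> in auto)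
  \<comment> \<open>An instance of \<open>A4\<close> exists because \<open>r\<close> exceeds a
    level, and by \<open>A1\<close> each level is at least \<open>\<epsilon>\<close>.\<close>
  have "\<epsilon> \<le> r + s"
    using r(1) s(1) level_ge[of "And \<xi> \<psi>"] level_nonneg[of "And \<xi> (Neg \<psi>)"]
    by (simp flip: real_of_nnrat_le_iff)
  then obtain t where t: "r + s = \<epsilon> + t" by (rule nnrat_le_imp_add)
  have "Neg (L t \<xi>) \<in> U"
    by (rule MP_mem[OF derives.A4[of t \<epsilon> r s _ \<xi> \<psi>]])
      (use r(1) s(1) t in \<open>auto simp: add.commute L_mem_iff\<close>)
  then have "level \<xi> < real_of_nnrat t" by (simp add: L_mem_iff)
  moreover have "real_of_nnrat r + real_of_nnrat s = real_of_nnrat \<epsilon> + real_of_nnrat t"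
    using t by (simp flip: real_of_nnrat_add)
  ultimately show False using r(2) s(2) unfolding \<delta>_def weight_def by argo
qed

lemma weight_additive: "weight \<xi> = weight (And \<xi> \<psi>) + weight (And \<xi> (Neg \<psi>))"
  using weight_superadditive weight_subadditive by (rule order_antisym[rotated])

text \<open>By \<open>R1\<close>, a rational separating the two levels in the wrong order would be
  accepted for \<open>\<psi>\<close> as well.\<close>

lemma weight_mono:
  assumes "derives \<epsilon> {} (Imp \<phi> \<psi>)"
  shows "weight \<phi> \<le> weight \<psi>"
proof (rule ccontr)
  assume "\<not> ?thesis"
  then obtain r where "L r \<phi> \<in> U" "level \<psi> < real_of_nnrat r"
    using less_levelE[of "level \<psi>" \<phi>] unfolding weight_def by auto
  then show False
    using MP_mem[OF derives.R1[OF assms, of _ r]] by (simp add: L_mem_iff)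
qed

lemma weight_cong: "(\<And>v. prop_eval v \<phi> \<longleftrightarrow> prop_eval v \<psi>) \<Longrightarrow> weight \<phi> = weight \<psi>"
  by (intro antisym weight_mono derives.Taut) (auto simp: tautology_def)

lemma weight_refutable:
  assumes "derives \<epsilon> {\<xi>} Bot"
  shows "weight \<xi> = 0"
proof -
  \<comment> \<open>Splitting \<open>Bot\<close> by \<open>Top\<close> gives two formulae equivalent
    to \<open>Bot\<close>, so its weight equals twice itself.\<close>
  have "weight Bot = weight (And Bot Top) + weight (And Bot (Neg Top))"
    by (rule weight_additive)
  also have "\<dots> = weight Bot + weight Bot"
    by (intro arg_cong2[where f = "(+)"] weight_cong) auto
  finally have "weight Bot = 0" by simp
  then show ?thesis
    using weight_mono[OF derives.ImpI[OF assms]] weight_nonneg[of \<xi>] by simp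
qed

end


section \<open>Types\<close>

text \<open>The list fixes the order of the conjuncts, while \<open>t\<close> only chooses their
  signs.\<close>

fun type_conj :: "fm list \<Rightarrow> fm set \<Rightarrow> fm" where
  "type_conj [] t = Top"
| "type_conj (\<sigma> # \<sigma>s) t = And (type_conj \<sigma>s t) (if \<sigma> \<in> t then \<sigma> else Neg \<sigma>)"

lemma prop_eval_type_conj:
  "prop_eval v (type_conj \<sigma>s t) \<longleftrightarrow> (\<forall>\<sigma>\<in>set \<sigma>s. \<sigma> \<in> t \<longleftrightarrow> prop_eval v \<sigma>)"
  by (induction \<sigma>s) auto

lemma (in saturated) type_conj_mem_iff:
  "type_conj \<sigma>s t \<in> U \<longleftrightarrow> (\<forall>\<sigma>\<in>set \<sigma>s. \<sigma> \<in> t \<longleftrightarrow> \<sigma> \<in> U)"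
  by (induction \<sigma>s) auto

text \<open>Induction on the list: additivity splits each summand by the new formula, and the
  subsets of the longer list are the old ones, with or without that formula.\<close>

lemma (in saturated) weight_eq_sum_types:
  assumes "distinct \<sigma>s"
  shows "weight \<xi> = (\<Sum>t\<in>Pow (set \<sigma>s). weight (And \<xi> (type_conj \<sigma>s t)))"
  using assms
proof (induction \<sigma>s)
  case Nil
  show ?case by (simp, rule weight_cong) simp
next
  case (Cons \<sigma> \<sigma>s)
  then have \<sigma>: "\<sigma> \<notin> set \<sigma>s" by simp
  have inj: "inj_on (insert \<sigma>) (Pow (set \<sigma>s))"
    using \<sigma> by (auto simp: inj_on_def)
  have disj: "Pow (set \<sigma>s) \<inter> insert \<sigma> ` Pow (set \<sigma>s) = {}"
    using \<sigma> by auto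
  have split: "weight (And \<xi> (type_conj \<sigma>s t))
      = weight (And \<xi> (type_conj (\<sigma> # \<sigma>s) t)) + weight (And \<xi> (type_conj (\<sigma> # \<sigma>s) (insert \<sigma> t)))"
    if "t \<in> Pow (set \<sigma>s)" for t
  proof -
    have "weight (And \<xi> (type_conj \<sigma>s t)) = weight (And (And \<xi> (type_conj \<sigma>s t)) \<sigma>)
        + weight (And (And \<xi> (type_conj \<sigma>s t)) (Neg \<sigma>))"
      by (rule weight_additive)
    moreover have "weight (And (And \<xi> (type_conj \<sigma>s t)) \<sigma>)
        = weight (And \<xi> (type_conj (\<sigma> # \<sigma>s) (insert \<sigma> t)))"
      using \<sigma> by (intro weight_cong) (auto simp: prop_eval_type_conj)
    moreover have "weight (And (And \<xi> (type_conj \<sigma>s t)) (Neg \<sigma>))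
        = weight (And \<xi> (type_conj (\<sigma> # \<sigma>s) t))"
      using \<sigma> that by (intro weight_cong) (auto simp: prop_eval_type_conj)
    ultimately show ?thesis by simp
  qed
  have "weight \<xi> = (\<Sum>t\<in>Pow (set \<sigma>s). weight (And \<xi> (type_conj \<sigma>s t)))"
    using Cons by simp
  also have "\<dots> = (\<Sum>t\<in>Pow (set \<sigma>s). weight (And \<xi> (type_conj (\<sigma> # \<sigma>s) t)))
      + (\<Sum>t\<in>Pow (set \<sigma>s). weight (And \<xi> (type_conj (\<sigma> # \<sigma>s) (insert \<sigma> t))))"
    using split by (simp only: sum.distrib[symmetric] cong: sum.cong)
  also have "\<dots> = (\<Sum>t\<in>Pow (set (\<sigma> # \<sigma>s)). weight (And \<xi> (type_conj (\<sigma> # \<sigma>s) t)))"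
    by (simp add: Pow_insert sum.union_disjoint[OF _ _ disj] sum.reindex[OF inj]
        del: type_conj.simps)
  finally show ?case .
qed

definition consistent_types :: "nnrat \<Rightarrow> fm list \<Rightarrow> fm set set" where
  "consistent_types \<epsilon> \<sigma>s = {t \<in> Pow (set \<sigma>s). \<not> derives \<epsilon> {type_conj \<sigma>s t} Bot}"

lemma (in saturated) weight_eq_sum_consistent_types:
  assumes "distinct \<sigma>s" "\<xi> \<in> set \<sigma>s"
  shows "weight \<xi> = (\<Sum>t\<in>{t \<in> consistent_types \<epsilon> \<sigma>s. \<xi> \<in> t}. weight (type_conj \<sigma>s t))"
proof -
  have zero: "weight (And \<xi> (type_conj \<sigma>s t)) = 0"
    if "t \<in> Pow (set \<sigma>s)" "t \<notin> {t \<in> consistent_types \<epsilon> \<sigma>s. \<xi> \<in> t}" for t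
  proof (rule weight_refutable)
    show "derives \<epsilon> {And \<xi> (type_conj \<sigma>s t)} Bot"
    proof (cases "\<xi> \<in> t")
      case True
      then have "derives \<epsilon> {type_conj \<sigma>s t} Bot"
        using that unfolding consistent_types_def by blast
      then have "derives \<epsilon> {And \<xi> (type_conj \<sigma>s t)} (Imp (type_conj \<sigma>s t) Bot)"
        by (intro derives.ImpI) (rule derives_weaken, auto)
      then show ?thesis
        by (rule derives_taut_2[OF _ derives.Hyp[OF singletonI]]) auto
    next
      case False
      then show ?thesis using assms(2)
        by (intro derives_taut_1[OF derives.Hyp[OF singletonI]]) (auto simp: prop_eval_type_conj)
    qed
  qed
  have "weight \<xi> = (\<Sum>t\<in>Pow (set \<sigma>s). weight (And \<xi> (type_conj \<sigma>s t)))"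
    by (rule weight_eq_sum_types[OF assms(1)])
  also have "\<dots> = (\<Sum>t\<in>{t \<in> consistent_types \<epsilon> \<sigma>s. \<xi> \<in> t}. weight (And \<xi> (type_conj \<sigma>s t)))"
    by (rule sum.mono_neutral_right) (use zero in \<open>auto simp: consistent_types_def\<close>)
  also have "\<dots> = (\<Sum>t\<in>{t \<in> consistent_types \<epsilon> \<sigma>s. \<xi> \<in> t}. weight (type_conj \<sigma>s t))"
    using assms(2) by (intro sum.cong weight_cong) (auto simp: prop_eval_type_conj)
  finally show ?thesis .
qed

primrec subformulae :: "fm \<Rightarrow> fm set" where
  "subformulae Top = {Top}"
| "subformulae (Neg \<phi>) = insert (Neg \<phi>) (subformulae \<phi>)"
| "subformulae (And \<phi> \<psi>) = insert (And \<phi> \<psi>) (subformulae \<phi> \<union> subformulae \<psi>)"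
| "subformulae (L r \<phi>) = insert (L r \<phi>) (subformulae \<phi>)"

lemma finite_subformulae: "finite (subformulae \<phi>)"
  by (induction \<phi>) auto

lemma self_mem_subformulae: "\<phi> \<in> subformulae \<phi>"
  by (cases \<phi>) auto

lemma subformulae_trans: "\<psi> \<in> subformulae \<phi> \<Longrightarrow> subformulae \<psi> \<subseteq> subformulae \<phi>"
  by (induction \<phi>) auto


section \<open>Finite kernels\<close>

text \<open>The definition asks for Polish spaces with points in \<open>real\<close>, so
  \<open>S\<close> is copied there. The copy is discrete and countable, hence Polish, and is its own
  image under the identity.\<close>

lemma analytic_topology_discrete_nat:
  "analytic_topology (discrete_topology (S :: nat set))"
  unfolding analytic_topology_def
proof (intro exI conjI)
  let ?Y = "discrete_topology (real ` S)"
  show "polish_topology ?Y"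
    by (simp add: polish_topology_def completely_metrizable_space_discrete_topology
        separable_space_discrete_topology countable_image)
  then show "polish_topology ?Y" .
  show "continuous_map ?Y ?Y id" by simp
  have "homeomorphic_map (discrete_topology S) ?Y real"
    by (intro bijective_open_imp_homeomorphic_map)
      (auto simp: open_map_into_discrete_topology inj_on_def)
  then show "discrete_topology S homeomorphic_space subtopology ?Y (id ` topspace ?Y)"
    by (auto simp: homeomorphic_map_imp_homeomorphic_space)
qed

lemma analytic_measurable_space_count_space_nat:
  "analytic_measurable_space (count_space (S :: nat set))"
proof -
  have "sigma_sets S (Pow S) = Pow S"
    by (rule sigma_algebra.sigma_sets_eq[OF sigma_algebra_Pow])
  moreover have "Collect (openin (discrete_topology S)) = Pow S" by auto
  ultimately show ?thesis
    unfolding analytic_measurable_space_def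
    by (intro exI[of _ "discrete_topology S"]) (simp add: analytic_topology_discrete_nat)
qed

text \<open>Every map out of a count space into the space of finite measures is measurable, so it
  remains to see that the total mass is finite; \<open>ennreal\<close> sends negative values of
  \<open>w\<close> to 0.\<close>

lemma CMK_point_measure:
  fixes S :: "nat set"
  assumes "finite S"
  shows "CMK (count_space S) (\<lambda>m. point_measure S (\<lambda>n. ennreal (w m n)))"
proof -
  have "point_measure S (\<lambda>n. ennreal (w m n)) \<in> finite_measures (count_space S)" for m
    using assms
    by (auto simp: finite_measures_def sets_point_measure space_point_measure
        emeasure_point_measure_finite intro!: finite_measureI)
  then show ?thesis
    unfolding CMK_def finite_measure_algebra_def
    by (auto simp: analytic_measurable_space_count_space_nat measurable_count_space_eq1
        space_measure_of_conv)
qed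

lemma measure_point_measure_real:
  assumes "finite S" "A \<subseteq> S" "\<And>x. 0 \<le> w x"
  shows "measure (point_measure S (\<lambda>x. ennreal (w x))) A = (\<Sum>x\<in>A. w x)"
  using assms by (simp add: measure_def emeasure_point_measure_finite sum_nonneg)

section \<open>The model on the consistent types\<close>

theorem theorem6:
  fixes \<epsilon> :: nnrat and \<phi> :: fm
  assumes "consistent \<epsilon> \<phi>"
  shows "\<exists>(N :: nat measure) (\<theta> :: nat \<Rightarrow> nat measure) (m :: nat).
           CMP N \<theta> m \<and> finite (space N) \<and> sat \<epsilon> N \<theta> \<phi> m"
proof -
  obtain \<sigma>s where \<sigma>s: "distinct \<sigma>s" "set \<sigma>s = subformulae \<phi>"
    using finite_distinct_list[OF finite_subformulae] by blast
  define T where "T = consistent_types \<epsilon> \<sigma>s"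
  have "finite T" unfolding T_def consistent_types_def by simp
  \<comment> \<open>The points of the model are natural-number codes of types; \<open>d\<close>
    below decodes them.\<close>
  obtain e :: "fm set \<Rightarrow> nat" where e: "inj_on e T"
    using finite_imp_inj_to_nat_seg[OF \<open>finite T\<close>] by blast
  have "\<exists>U. saturated \<epsilon> U \<and> type_conj \<sigma>s t \<in> U" if "t \<in> T" for t
  proof -
    have "\<not> derives \<epsilon> {type_conj \<sigma>s t} Bot"
      using that unfolding T_def consistent_types_def by blast
    then show ?thesis by (rule saturated_extension) blast
  qed
  then obtain U where U: "\<And>t. t \<in> T \<Longrightarrow> saturated \<epsilon> (U t)"
    and U_type: "\<And>t. t \<in> T \<Longrightarrow> type_conj \<sigma>s t \<in> U t"
    by metis
  \<comment> \<open>Since \<open>U t\<close> contains the description of \<open>t\<close>, it agrees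
    with \<open>t\<close> on all subformulae of \<open>\<phi>\<close>. Boolean closure of types is
    thus inherited from \<open>U t\<close>.\<close>
  have mem_U: "\<xi> \<in> U t \<longleftrightarrow> \<xi> \<in> t" if "t \<in> T" "\<xi> \<in> subformulae \<phi>" for t \<xi>
    using saturated.type_conj_mem_iff[OF U[OF that(1)]] U_type that \<sigma>s(2) by blast
  define d where "d = the_inv_into T e"
  have d: "d (e t) = t" if "t \<in> T" for t
    unfolding d_def using e that by (rule the_inv_into_f_f)
  \<comment> \<open>The truncation makes \<open>w\<close> nonnegative also where \<open>d m \<notin> T\<close>, where \<open>U (d m)\<close> is arbitrary.\<close>
  define w where "w m n = max 0 (saturated.weight \<epsilon> (U (d m)) (type_conj \<sigma>s (d n)))" for m n
  define N where "N = count_space (e ` T)"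
  define \<theta> where "\<theta> m = point_measure (e ` T) (\<lambda>n. ennreal (w m n))" for m
  have truth: "sat \<epsilon> N \<theta> \<psi> (e t) \<longleftrightarrow> \<psi> \<in> t" if "\<psi> \<in> subformulae \<phi>" "t \<in> T" for \<psi> t
    using that
  proof (induction \<psi> arbitrary: t)
    case Top
    then show ?case using saturated.Top_mem[OF U] mem_U by simp
  next
    case (Neg \<psi>)
    have "\<psi> \<in> subformulae \<phi>"
      using subformulae_trans[OF Neg.prems(1)] self_mem_subformulae by auto
    then show ?case
      using Neg saturated.Neg_mem_iff[OF U] mem_U by (metis sat.simps(2))
  next
    case (And \<psi>1 \<psi>2)
    have "\<psi>1 \<in> subformulae \<phi>" "\<psi>2 \<in> subformulae \<phi>"
      using subformulae_trans[OF And.prems(1)] self_mem_subformulae by auto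
    then show ?case
      using And saturated.And_mem_iff[OF U] mem_U by (metis sat.simps(3))
  next
    case (L r \<psi>)
    interpret saturated \<epsilon> "U t" using U L.prems(2) .
    have \<psi>: "\<psi> \<in> subformulae \<phi>"
      using subformulae_trans[OF L.prems(1)] self_mem_subformulae by auto
    \<comment> \<open>The induction hypothesis at all types identifies the truth set of
      \<open>\<psi>\<close> with the types containing it. Their masses add up to the weight of
      \<open>\<psi>\<close> in \<open>U t\<close>, that is, its level minus
      \<open>\<epsilon>\<close>; the semantics adds \<open>\<epsilon>\<close> back.\<close>
    have "{n \<in> space N. sat \<epsilon> N \<theta> \<psi> n} = e ` {t' \<in> T. \<psi> \<in> t'}"
      using L.IH[OF \<psi>] unfolding N_def by auto
    then have "measure (\<theta> (e t)) {n \<in> space N. sat \<epsilon> N \<theta> \<psi> n} = (\<Sum>n\<in>e ` {t' \<in> T. \<psi> \<in> t'}. w (e t) n)"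
      unfolding \<theta>_def
      using \<open>finite T\<close> by (simp add: measure_point_measure_real w_def image_mono)
    also have "\<dots> = (\<Sum>t'\<in>{t' \<in> T. \<psi> \<in> t'}. weight (type_conj \<sigma>s t'))"
      by (subst sum.reindex) (use e L.prems(2) weight_nonneg in \<open>auto simp: inj_on_def w_def d max_def\<close>)
    also have "\<dots> = weight \<psi>"
      using weight_eq_sum_consistent_types[OF \<sigma>s(1)] \<psi> \<sigma>s(2) unfolding T_def by simp
    finally show ?case
      using L_mem_iff[of r \<psi>] mem_U[OF L.prems(2,1)] unfolding weight_def by simp
  qed
  have "\<not> derives \<epsilon> {\<phi>} Bot"
    using assms derives.ImpI unfolding consistent_def provable_def by blast
  then obtain V where V: "saturated \<epsilon> V" "\<phi> \<in> V"
    using saturated_extension by blast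
  interpret saturated \<epsilon> V by (rule V(1))
  \<comment> \<open>The type realized by \<open>V\<close>: its description lies in \<open>V\<close>
    and is therefore consistent, so \<open>t\<close> is a point of the model, and it contains
    \<open>\<phi>\<close>.\<close>
  define t where "t = V \<inter> subformulae \<phi>"
  have "type_conj \<sigma>s t \<in> V"
    unfolding type_conj_mem_iff t_def using \<sigma>s(2) by blast
  then have "t \<in> T"
    unfolding T_def consistent_types_def
    using finitely_consistent[of "{type_conj \<sigma>s t}"] \<sigma>s(2) by (auto simp: t_def)
  have "CMK N \<theta>"
    unfolding N_def \<theta>_def[abs_def] using \<open>finite T\<close> by (intro CMK_point_measure) simp
  then have "CMP N \<theta> (e t)"
    using \<open>t \<in> T\<close> unfolding CMP_def N_def by simp
  moreover have "finite (space N)" using \<open>finite T\<close> unfolding N_def by simp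
  moreover have "sat \<epsilon> N \<theta> \<phi> (e t)"
    using truth[OF self_mem_subformulae \<open>t \<in> T\<close>] V(2) self_mem_subformulae unfolding t_def by blast
  ultimately show ?thesis by blast
qed

end
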